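(* Let $\mathbf{A}\in\mathbb{R}^{N\times N}$ be symmetric with eigenpairs $(\lambda_j,\bm{v}_j)$, $j=1,\dots,N$, where $\bm{v}_1,\dots,\bm{v}_N$ are orthonormal and $1=\lambda_1>|\lambda_2|\ge\cdots\ge|\lambda_N|$. Let $k=k_1+k_2$ with $k_1,k_2\in\mathbb{N}$, and let $\bm{\widehat{x}}_0\in\mathbb{R}^N$ be a deterministic initial approximation with $\bm{v}_1^\top\bm{\widehat{x}}_0\neq0$. Consider $k_1$ iterations of the update $$\bm{\widehat{x}}_{q}=\frac{N}{\mathbb{E}[T]}\mathbf{D}_{\mathcal{T}_q}\mathbf{A}\,\bm{\widehat{x}}_{q-1},\qquad q=1,\dots,k_1,$$ followed by $k_2$ iterations of the update $$\bm{\widehat{x}}_{q}=[\mathbf{I}+\mathbf{D}_{\mathcal{T}_q}(\mathbf{A}-\mathbf{I})]\,\bm{\widehat{x}}_{q-1},\qquad q=k_1+1,\dots,k_1+k_2.$$ Then, for every $j=1,\dots,N$, $$\mathbb{E}[\bm{v}_j^\top\bm{\widehat{x}}_{k}]=\lambda_j^{k_1}\left[1+\frac{\mathbb{E}[T]}{N}(\lambda_j-1)\right]^{k_2}\bm{v}_j^\top\bm{\widehat{x}}_{0}.$$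
   Context: $\mathbb{N}$ is the set of positive integers. For a subset $\mathcal{S}\subseteq\{1,\dots,N\}$, $\mathbf{D}_{\mathcal{S}}=\sum_{i\in\mathcal{S}}\bm{e}_i\bm{e}_i^\top$, where $\bm{e}_i$ is the $i$-th column of the $N\times N$ identity matrix $\mathbf{I}$. Random index sets: fix integers $1\le\gamma_1\le\gamma_2\le N$. $T$ is a random integer uniformly distributed on $\{\gamma_1,\dots,\gamma_2\}$, and, given $T$, $\mathcal{T}$ is a uniformly distributed size-$T$ subset of $\{1,\dots,N\}$. The pairs $(T_q,\mathcal{T}_q)$, $q\ge1$, are independent and identically distributed copies of $(T,\mathcal{T})$. *)

theory Defs
  imports "HOL-Probability.Probability"
begin

text \<open>Vectors in \<open>\<real>\<^sup>N\<close> have type \<open>real ^ 'n\<close> with \<open>N = CARD('n)\<close>; a subset of the coordinate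
  indices is a value of type \<open>'n set\<close>.\<close>

definition coord_proj :: "'n set \<Rightarrow> real ^ 'n ^ 'n" where
  "coord_proj S =
     (\<Sum>i\<in>S. (columnvector (column i (mat 1)) :: real ^ 1 ^ 'n) **
            (rowvector (column i (mat 1)) :: real ^ 'n ^ 1))"

definition size_law :: "nat \<Rightarrow> nat \<Rightarrow> nat pmf" where
  "size_law \<gamma>1 \<gamma>2 = pmf_of_set {\<gamma>1..\<gamma>2}"

text \<open>\<open>pmf_of_set\<close> is only meaningful on nonempty finite sets, so the next law is the intended one
  only if \<open>\<gamma>1 \<le> \<gamma>2 \<le> CARD('n)\<close>.\<close>

definition index_law :: "nat \<Rightarrow> nat \<Rightarrow> (nat \<times> 'n::finite set) pmf" where
  "index_law \<gamma>1 \<gamma>2 =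
     bind_pmf (size_law \<gamma>1 \<gamma>2) (\<lambda>t.
       map_pmf (\<lambda>S. (t, S)) (pmf_of_set {S :: 'n set. card S = t}))"

definition mean_size :: "nat \<Rightarrow> nat \<Rightarrow> real" where
  "mean_size \<gamma>1 \<gamma>2 = measure_pmf.expectation (size_law \<gamma>1 \<gamma>2) real"

end

theory Submission
  imports Defs
begin

text \<open>
  Every iteration multiplies the current vector by a random matrix that depends only on the fresh
  index set \<open>\<T> q\<close>, whereas the current vector depends only on the earlier index sets. So the
  expectation of their product factorises, and each step acts on expectations through the mean
  of its random matrix alone.

  That mean is explicit: a coordinate lies in a uniformly chosen subset of size \<open>t\<close> with
  probability \<open>t / N\<close>, hence in the random index set with probability \<open>p = E[T] / N\<close>, and the mean
  of the coordinate projection is \<open>p\<close> times the identity. The two kinds of steps therefore have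
  mean matrices \<open>A\<close> and \<open>I + p (A - I)\<close>. As \<open>A\<close> is symmetric, \<open>v j\<close> is a left eigenvector of both,
  for the eigenvalues \<open>lam j\<close> and \<open>1 + p (lam j - 1)\<close>, and these numbers multiply over the steps
  (\<open>expectation_step_left_eigenvector\<close>). There are only finitely many index sets, so every random
  variable that occurs takes finitely many values and is integrable.
\<close>

section \<open>Coordinate projections\<close>

lemma coord_proj_nth:
  fixes S :: "'n::finite set"
  shows "coord_proj S $ a $ b = (if a = b \<and> a \<in> S then 1 else 0)"
proof -
  have "coord_proj S $ a $ b = (\<Sum>i\<in>S. if i = a then (if i = b then 1 else 0) else 0)"
    unfolding coord_proj_def sum_component
    by (rule sum.cong)
       (auto simp: columnvector_def rowvector_def column_def mat_def matrix_matrix_mult_def)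
  also have "\<dots> = (if a = b \<and> a \<in> S then 1 else 0)"
    by (subst sum.delta) auto
  finally show ?thesis .
qed

lemma vector_coord_proj_nth:
  fixes S :: "'n::finite set"
  shows "(w v* coord_proj S) $ i = w $ i * indicator S i"
proof -
  have "(w v* coord_proj S) $ i = (\<Sum>a\<in>UNIV. if a = i then w $ a * indicator S a else 0)"
    unfolding vector_matrix_mult_def vec_lambda_beta
    by (rule sum.cong) (auto simp: coord_proj_nth indicator_def)
  then show ?thesis by simp
qed

text \<open>Since each entry of the random row vector is a deterministic linear combination of the
  indicators \<open>i \<in> S\<close>, averaging over \<open>S\<close> replaces the projection by a scalar.\<close>

lemma mean_vector_coord_proj_matrix:
  fixes S :: "'w \<Rightarrow> 'n::finite set" and B :: "real ^ 'm ^ 'n"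
  assumes int: "\<And>i. integrable M (\<lambda>\<omega>. indicator (S \<omega>) i :: real)"
    and mean: "\<And>i. (\<integral>\<omega>. indicator (S \<omega>) i \<partial>M) = (p :: real)"
  shows "integrable M (\<lambda>\<omega>. (w v* (coord_proj (S \<omega>) ** B)) $ b)"
    and "(\<integral>\<omega>. (w v* (coord_proj (S \<omega>) ** B)) $ b \<partial>M) = p * (w v* B) $ b"
proof -
  have expand: "(w v* (coord_proj (S \<omega>) ** B)) $ b
      = (\<Sum>i\<in>UNIV. (B $ i $ b * w $ i) * indicator (S \<omega>) i)" for \<omega>
    unfolding vector_matrix_mul_assoc[symmetric]
    by (simp add: vector_matrix_mult_def[of _ B] vector_coord_proj_nth mult_ac)
  show "integrable M (\<lambda>\<omega>. (w v* (coord_proj (S \<omega>) ** B)) $ b)"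
    unfolding expand by (intro Bochner_Integration.integrable_sum integrable_mult_right int)
  have "(\<integral>\<omega>. (w v* (coord_proj (S \<omega>) ** B)) $ b \<partial>M) = (\<Sum>i\<in>UNIV. (B $ i $ b * w $ i) * p)"
    unfolding expand by (subst Bochner_Integration.integral_sum) (auto simp: int mean)
  also have "\<dots> = p * (w v* B) $ b"
    by (simp add: vector_matrix_mult_def sum_distrib_left mult_ac)
  finally show "(\<integral>\<omega>. (w v* (coord_proj (S \<omega>) ** B)) $ b \<partial>M) = p * (w v* B) $ b" .
qed

section \<open>Inclusion probabilities\<close>

text \<open>Counting the sets that avoid \<open>i\<close> is counting subsets of the complement of \<open>i\<close>; Pascal's rule
  and the absorption identity turn the difference into the fraction \<open>t / N\<close> of all sets.\<close>

lemma card_subsets_containing: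
  fixes i :: "'n::finite"
  shows "CARD('n) * card {S :: 'n set. card S = t \<and> i \<in> S} = t * card {S :: 'n set. card S = t}"
proof (cases t)
  case 0
  have "{S :: 'n set. card S = t \<and> i \<in> S} = {}"
    using 0 by auto
  then show ?thesis using 0 by (metis card.empty mult_0 mult_0_right)
next
  case (Suc s)
  obtain m where N: "CARD('n) = Suc m"
    by (metis finite_UNIV_card_ge_0 finite gr0_implies_Suc)
  have all: "card {S :: 'n set. card S = t} = Suc m choose t"
    using n_subsets[of "UNIV :: 'n set" t] N by simp
  have "card {S. S \<subseteq> UNIV - {i} \<and> card S = t} = m choose t"
    using n_subsets[of "UNIV - {i}" t] N by (simp add: card_Diff_singleton)
  moreover have "{S. S \<subseteq> UNIV - {i} \<and> card S = t} = {S. card S = t \<and> i \<notin> S}"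
    by auto
  ultimately have avoid: "card {S. card S = t \<and> i \<notin> S} = m choose t"
    by simp
  have "{S. card S = t} = {S. card S = t \<and> i \<in> S} \<union> {S. card S = t \<and> i \<notin> S}"
    by auto
  then have "card {S :: 'n set. card S = t}
      = card {S. card S = t \<and> i \<in> S} + card {S. card S = t \<and> i \<notin> S}"
    by (metis (no_types, lifting) card_Un_disjoint finite disjoint_iff mem_Collect_eq)
  then have "card {S. card S = t \<and> i \<in> S} = m choose s"
    using all avoid Suc by simp
  then show ?thesis
    using Suc_times_binomial_eq[of m s] N Suc all by (simp add: mult.commute)
qed

lemma inclusion_prob_fixed_size:
  fixes i :: "'n::finite"
  assumes "t \<le> CARD('n)"
  shows "measure_pmf.expectation (pmf_of_set {S :: 'n set. card S = t}) (\<lambda>S. indicator S i)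
           = real t / CARD('n)"
proof -
  let ?C = "{S :: 'n set. card S = t}"
  have ne: "?C \<noteq> {}"
    using obtain_subset_with_card_n[OF assms] by auto
  have "measure_pmf.expectation (pmf_of_set ?C) (\<lambda>S. indicator S i :: real)
      = (\<Sum>S\<in>?C. indicator S i) / card ?C"
    by (rule integral_pmf_of_set) (use ne in auto)
  also have "(\<Sum>S\<in>?C. indicator S i :: real) = card {S :: 'n set. card S = t \<and> i \<in> S}"
    by (simp add: indicator_def sum.If_cases Collect_conj_eq[symmetric])
  also have "real (card {S :: 'n set. card S = t \<and> i \<in> S}) / card ?C = real t / CARD('n)"
  proof -
    have "real CARD('n) * card {S :: 'n set. card S = t \<and> i \<in> S} = real t * card ?C"
      using card_subsets_containing[of t i] by (metis of_nat_mult)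
    moreover have "real (card ?C) \<noteq> 0"
      using ne by (metis card_eq_0_iff finite of_nat_eq_0_iff)
    moreover have "real CARD('n) \<noteq> 0"
      by simp
    ultimately show ?thesis
      by (metis frac_eq_eq mult.commute)
  qed
  finally show ?thesis .
qed

lemma inclusion_prob_index_law:
  fixes i :: "'n::finite"
  assumes "\<gamma>1 \<le> \<gamma>2" and "\<gamma>2 \<le> CARD('n)"
  shows "measure_pmf.expectation (index_law \<gamma>1 \<gamma>2) (\<lambda>z :: nat \<times> 'n set. indicator (snd z) i)
           = mean_size \<gamma>1 \<gamma>2 / CARD('n)"
proof -
  have supp: "set_pmf (size_law \<gamma>1 \<gamma>2) = {\<gamma>1..\<gamma>2}"
    unfolding size_law_def using assms by (simp add: set_pmf_of_set)
  have "measure_pmf.expectation (index_law \<gamma>1 \<gamma>2) (\<lambda>z :: nat \<times> 'n set. indicator (snd z) i :: real)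
     = (\<Sum>t\<in>{\<gamma>1..\<gamma>2}. pmf (size_law \<gamma>1 \<gamma>2) t *\<^sub>R
          measure_pmf.expectation (map_pmf (\<lambda>S. (t, S)) (pmf_of_set {S :: 'n set. card S = t}))
            (\<lambda>z. indicator (snd z) i))"
    unfolding index_law_def
    by (rule pmf_expectation_bind) (auto simp: supp)
  also have "\<dots> = (\<Sum>t\<in>{\<gamma>1..\<gamma>2}. pmf (size_law \<gamma>1 \<gamma>2) t * (real t / CARD('n)))"
    using assms by (intro sum.cong) (auto simp: inclusion_prob_fixed_size)
  also have "\<dots> = (\<Sum>t\<in>{\<gamma>1..\<gamma>2}. real t * pmf (size_law \<gamma>1 \<gamma>2) t) / CARD('n)"
    by (simp add: sum_divide_distrib mult.commute)
  also have "(\<Sum>t\<in>{\<gamma>1..\<gamma>2}. real t * pmf (size_law \<gamma>1 \<gamma>2) t) = mean_size \<gamma>1 \<gamma>2"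
    unfolding mean_size_def by (rule integral_measure_pmf_real[symmetric]) (auto simp: supp)
  finally show ?thesis .
qed

lemma mean_size_pos:
  assumes "1 \<le> \<gamma>1" and "\<gamma>1 \<le> \<gamma>2"
  shows "mean_size \<gamma>1 \<gamma>2 > 0"
proof -
  have "mean_size \<gamma>1 \<gamma>2 = (\<Sum>t\<in>{\<gamma>1..\<gamma>2}. real t) / card {\<gamma>1..\<gamma>2}"
    unfolding mean_size_def size_law_def by (rule integral_pmf_of_set) (use assms in auto)
  moreover have "(\<Sum>t\<in>{\<gamma>1..\<gamma>2}. real t) > 0"
    by (rule sum_pos) (use assms in auto)
  ultimately show ?thesis
    using assms by simp
qed

section \<open>Recursions driven by independent finite noise\<close>

context prob_space
begin

lemma indep_vars_measurable:
  "indep_vars M' X I \<Longrightarrow> i \<in> I \<Longrightarrow> X i \<in> measurable M (M' i)"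
  by (simp add: indep_vars_def2)

lemma integrable_fun_of_finite:
  fixes H :: "'a \<Rightarrow> 's" and f :: "'s \<Rightarrow> real"
  assumes "H \<in> measurable M (count_space C)" and "finite C"
  shows "integrable M (\<lambda>\<omega>. f (H \<omega>))"
proof (rule integrable_const_bound)
  have "H \<omega> \<in> C" if "\<omega> \<in> space M" for \<omega>
    using measurable_space[OF assms(1) that] by simp
  then show "AE \<omega> in M. norm (f (H \<omega>)) \<le> Max ((\<lambda>c. norm (f c)) ` C)"
    using assms(2) by (intro AE_I2 Max_ge) auto
  show "(\<lambda>\<omega>. f (H \<omega>)) \<in> borel_measurable M"
    using assms(1) by (rule measurable_compose) simp
qed

text \<open>Unrolling the recursion leaves only the inputs already read. Independence of the state from the
  next input then reduces to independence among the inputs.\<close>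

lemma state_fun_of_history:
  fixes Z :: "nat \<Rightarrow> 'a \<Rightarrow> 's" and y :: "nat \<Rightarrow> 'a \<Rightarrow> 'b"
  assumes "\<And>\<omega>. \<omega> \<in> space M \<Longrightarrow> y 0 \<omega> = y0"
    and step: "\<And>q \<omega>. 1 \<le> q \<Longrightarrow> q \<le> n \<Longrightarrow> \<omega> \<in> space M \<Longrightarrow> y q \<omega> = F q (Z q \<omega>) (y (q - 1) \<omega>)"
    and "q \<le> n"
  shows "\<exists>g. \<forall>\<omega>\<in>space M. y q \<omega> = g (\<lambda>i\<in>{1..q}. Z i \<omega>)"
  using \<open>q \<le> n\<close>
proof (induction q)
  case 0
  then show ?case using assms(1) by (intro exI[of _ "\<lambda>_. y0"]) simp
next
  case (Suc q)
  then obtain g where g: "\<forall>\<omega>\<in>space M. y q \<omega> = g (\<lambda>i\<in>{1..q}. Z i \<omega>)"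
    using Suc.IH[OF Suc_leD[OF Suc.prems]] by blast
  have cut: "restrict (\<lambda>i\<in>{1..Suc q}. Z i \<omega>) {1..q} = (\<lambda>i\<in>{1..q}. Z i \<omega>)" for \<omega>
    by (auto simp: restrict_def)
  show ?case
  proof (intro exI[of _ "\<lambda>z. F (Suc q) (z (Suc q)) (g (restrict z {1..q}))"] ballI)
    fix \<omega> assume "\<omega> \<in> space M"
    then show "y (Suc q) \<omega> = F (Suc q) ((\<lambda>i\<in>{1..Suc q}. Z i \<omega>) (Suc q))
        (g (restrict (\<lambda>i\<in>{1..Suc q}. Z i \<omega>) {1..q}))"
      unfolding cut using g step[of "Suc q"] Suc.prems by simp
  qed
qed

lemma history_measurable:
  fixes Z :: "nat \<Rightarrow> 'a \<Rightarrow> 's::finite"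
  assumes "indep_vars (\<lambda>_. count_space UNIV) Z {1..}"
  shows "(\<lambda>\<omega>. \<lambda>i\<in>{1..q}. Z i \<omega>) \<in> measurable M (count_space (PiE {1..q} (\<lambda>_. UNIV)))"
proof -
  have "(\<lambda>\<omega>. \<lambda>i\<in>{1..q}. Z i \<omega>) \<in> measurable M (PiM {1..q} (\<lambda>_. count_space UNIV))"
    using indep_vars_measurable[OF assms] by (intro measurable_restrict) simp
  then show ?thesis
    by (subst (asm) count_space_PiM_finite) auto
qed

lemma state_integrable:
  fixes Z :: "nat \<Rightarrow> 'a \<Rightarrow> 's::finite" and y :: "nat \<Rightarrow> 'a \<Rightarrow> 'b" and f :: "'b \<Rightarrow> real"
  assumes ind: "indep_vars (\<lambda>_. count_space UNIV) Z {1..}"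
    and "\<And>\<omega>. \<omega> \<in> space M \<Longrightarrow> y 0 \<omega> = y0"
    and "\<And>q \<omega>. 1 \<le> q \<Longrightarrow> q \<le> n \<Longrightarrow> \<omega> \<in> space M \<Longrightarrow> y q \<omega> = F q (Z q \<omega>) (y (q - 1) \<omega>)"
    and "q \<le> n"
  shows "integrable M (\<lambda>\<omega>. f (y q \<omega>))"
proof -
  obtain g where g: "\<forall>\<omega>\<in>space M. y q \<omega> = g (\<lambda>i\<in>{1..q}. Z i \<omega>)"
    using state_fun_of_history[of y y0 n F Z q] assms by auto
  have "integrable M (\<lambda>\<omega>. f (g (\<lambda>i\<in>{1..q}. Z i \<omega>)))"
    by (rule integrable_fun_of_finite[OF history_measurable[OF ind, of q]]) (auto intro: finite_PiE)
  then show ?thesis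
    by (subst Bochner_Integration.integrable_cong[OF refl]) (use g in auto)
qed

text \<open>Disjoint blocks of independent inputs are independent: the next input on one side, the
  history that determines the state on the other.\<close>

lemma expectation_input_times_state:
  fixes Z :: "nat \<Rightarrow> 'a \<Rightarrow> 's::finite" and y :: "nat \<Rightarrow> 'a \<Rightarrow> 'b"
    and h :: "'s \<Rightarrow> real" and f :: "'b \<Rightarrow> real"
  assumes ind: "indep_vars (\<lambda>_. count_space UNIV) Z {1..}"
    and "\<And>\<omega>. \<omega> \<in> space M \<Longrightarrow> y 0 \<omega> = y0"
    and "\<And>q \<omega>. 1 \<le> q \<Longrightarrow> q \<le> n \<Longrightarrow> \<omega> \<in> space M \<Longrightarrow> y q \<omega> = F q (Z q \<omega>) (y (q - 1) \<omega>)"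
    and "q \<le> n"
  shows "integrable M (\<lambda>\<omega>. h (Z (Suc q) \<omega>) * f (y q \<omega>))"
    and "expectation (\<lambda>\<omega>. h (Z (Suc q) \<omega>) * f (y q \<omega>))
           = expectation (\<lambda>\<omega>. h (Z (Suc q) \<omega>)) * expectation (\<lambda>\<omega>. f (y q \<omega>))"
proof -
  let ?H = "\<lambda>\<omega>. \<lambda>i\<in>{1..q}. Z i \<omega>"
  obtain g where g: "\<forall>\<omega>\<in>space M. y q \<omega> = g (?H \<omega>)"
    using state_fun_of_history[of y y0 n F Z q] assms by auto
  have Zm: "Z (Suc q) \<in> measurable M (count_space UNIV)"
    using indep_vars_measurable[OF ind] by simp
  have int_h: "integrable M (\<lambda>\<omega>. h (Z (Suc q) \<omega>))"
    by (rule integrable_fun_of_finite[OF Zm]) simp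
  have int_f: "integrable M (\<lambda>\<omega>. f (g (?H \<omega>)))"
    by (rule integrable_fun_of_finite[OF history_measurable[OF ind, of q]]) (auto intro: finite_PiE)
  have blocks: "indep_var (PiM {Suc q} (\<lambda>_. count_space UNIV)) (\<lambda>\<omega>. \<lambda>i\<in>{Suc q}. Z i \<omega>)
      (PiM {1..q} (\<lambda>_. count_space UNIV)) ?H"
    by (rule indep_var_restrict[OF ind]) auto
  have "indep_var borel ((\<lambda>z. h (z (Suc q))) \<circ> (\<lambda>\<omega>. \<lambda>i\<in>{Suc q}. Z i \<omega>)) borel ((\<lambda>z. f (g z)) \<circ> ?H)"
    by (rule indep_var_compose[OF blocks]) (subst count_space_PiM_finite; auto)+
  then have indep: "indep_var borel (\<lambda>\<omega>. h (Z (Suc q) \<omega>)) borel (\<lambda>\<omega>. f (g (?H \<omega>)))"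
    by (simp add: comp_def)
  show "integrable M (\<lambda>\<omega>. h (Z (Suc q) \<omega>) * f (y q \<omega>))"
    using indep_var_integrable[OF indep int_h int_f]
    by (subst Bochner_Integration.integrable_cong[OF refl]) (use g in auto)
  have "expectation (\<lambda>\<omega>. h (Z (Suc q) \<omega>) * f (y q \<omega>))
      = expectation (\<lambda>\<omega>. h (Z (Suc q) \<omega>) * f (g (?H \<omega>)))"
    using g by (intro Bochner_Integration.integral_cong) auto
  also have "\<dots> = expectation (\<lambda>\<omega>. h (Z (Suc q) \<omega>)) * expectation (\<lambda>\<omega>. f (g (?H \<omega>)))"
    by (rule indep_var_lebesgue_integral[OF indep int_h int_f])
  also have "expectation (\<lambda>\<omega>. f (g (?H \<omega>))) = expectation (\<lambda>\<omega>. f (y q \<omega>))"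
    using g by (intro Bochner_Integration.integral_cong) auto
  finally show "expectation (\<lambda>\<omega>. h (Z (Suc q) \<omega>) * f (y q \<omega>))
      = expectation (\<lambda>\<omega>. h (Z (Suc q) \<omega>)) * expectation (\<lambda>\<omega>. f (y q \<omega>))" .
qed

text \<open>Conditioning on the past would give \<open>E[w \<bullet> R y | y] = (w v* E[R]) \<bullet> y\<close>; with finitely many
  values, independence applied to each coordinate of the row vector \<open>w v* R\<close> suffices.\<close>

lemma expectation_step_left_eigenvector:
  fixes Z :: "nat \<Rightarrow> 'a \<Rightarrow> 's::finite" and y :: "nat \<Rightarrow> 'a \<Rightarrow> real ^ 'n"
    and R :: "nat \<Rightarrow> 's \<Rightarrow> real ^ 'n ^ 'n"
  assumes ind: "indep_vars (\<lambda>_. count_space UNIV) Z {1..}"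
    and start: "\<And>\<omega>. \<omega> \<in> space M \<Longrightarrow> y 0 \<omega> = y0"
    and step: "\<And>q \<omega>. 1 \<le> q \<Longrightarrow> q \<le> n \<Longrightarrow> \<omega> \<in> space M \<Longrightarrow> y q \<omega> = R q (Z q \<omega>) *v y (q - 1) \<omega>"
    and "Suc q \<le> n"
    and eigen: "\<And>b. expectation (\<lambda>\<omega>. (w v* R (Suc q) (Z (Suc q) \<omega>)) $ b) = \<mu> * w $ b"
  shows "expectation (\<lambda>\<omega>. w \<bullet> y (Suc q) \<omega>) = \<mu> * expectation (\<lambda>\<omega>. w \<bullet> y q \<omega>)"
proof -
  let ?r = "\<lambda>b s. (w v* R (Suc q) s) $ b"
  have "q \<le> n" using \<open>Suc q \<le> n\<close> by simp
  note factor = expectation_input_times_state[of Z y y0 n "\<lambda>q s. (*v) (R q s)" q,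
      OF ind start step \<open>q \<le> n\<close>]
  have int_y: "integrable M (\<lambda>\<omega>. y q \<omega> $ b)" for b
    by (rule state_integrable[of Z y y0 n "\<lambda>q s. (*v) (R q s)" q "\<lambda>u. u $ b",
          OF ind start step \<open>q \<le> n\<close>])
  have "expectation (\<lambda>\<omega>. w \<bullet> y (Suc q) \<omega>)
      = expectation (\<lambda>\<omega>. \<Sum>b\<in>UNIV. ?r b (Z (Suc q) \<omega>) * y q \<omega> $ b)"
    using step[of "Suc q"] \<open>Suc q \<le> n\<close>
    by (intro Bochner_Integration.integral_cong)
       (simp_all add: dot_lmul_matrix[symmetric], simp add: inner_vec_def)
  also have "\<dots> = (\<Sum>b\<in>UNIV. expectation (\<lambda>\<omega>. ?r b (Z (Suc q) \<omega>) * y q \<omega> $ b))"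
    by (rule Bochner_Integration.integral_sum) (rule factor(1))
  also have "\<dots> = (\<Sum>b\<in>UNIV. \<mu> * (w $ b * expectation (\<lambda>\<omega>. y q \<omega> $ b)))"
    using factor(2)[where h = "?r b" and f = "\<lambda>u. u $ b" for b] by (simp add: eigen mult.assoc)
  also have "\<dots> = \<mu> * expectation (\<lambda>\<omega>. w \<bullet> y q \<omega>)"
    by (simp add: inner_vec_def Bochner_Integration.integral_sum int_y sum_distrib_left)
  finally show ?thesis .
qed

end

section \<open>The expectation of the eigenvector coefficients\<close>

theorem proposition3:
  fixes A :: "real ^ 'n ^ 'n"
    and lam :: "nat \<Rightarrow> real"
    and v :: "nat \<Rightarrow> real ^ 'n"
    and M :: "'w measure"
    and T :: "nat \<Rightarrow> 'w \<Rightarrow> nat"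
    and \<T> :: "nat \<Rightarrow> 'w \<Rightarrow> 'n set"
    and \<gamma>1 \<gamma>2 k k1 k2 :: nat
    and x0 :: "real ^ 'n"
    and x :: "nat \<Rightarrow> 'w \<Rightarrow> real ^ 'n"
  assumes "1 \<le> \<gamma>1" and "\<gamma>1 \<le> \<gamma>2" and "\<gamma>2 \<le> CARD('n)"
    and "prob_space M"
    and "prob_space.indep_vars M (\<lambda>_. count_space UNIV) (\<lambda>q \<omega>. (T q \<omega>, \<T> q \<omega>)) {1..}"
    and "\<And>q. 1 \<le> q \<Longrightarrow>
           distr M (count_space UNIV) (\<lambda>\<omega>. (T q \<omega>, \<T> q \<omega>)) = measure_pmf (index_law \<gamma>1 \<gamma>2)"
    and "transpose A = A"
    and "\<And>j. j \<in> {1..CARD('n)} \<Longrightarrow> A *v v j = lam j *\<^sub>R v j"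
    and "\<And>i j. i \<in> {1..CARD('n)} \<Longrightarrow> j \<in> {1..CARD('n)} \<Longrightarrow>
           v i \<bullet> v j = (if i = j then 1 else 0)"
    and "lam 1 = 1"
    and "2 \<le> CARD('n) \<Longrightarrow> lam 1 > \<bar>lam 2\<bar>"
    and "\<And>i j. 2 \<le> i \<Longrightarrow> i \<le> j \<Longrightarrow> j \<le> CARD('n) \<Longrightarrow> \<bar>lam i\<bar> \<ge> \<bar>lam j\<bar>"
    and "1 \<le> k1" and "1 \<le> k2" and "k = k1 + k2"
    and "v 1 \<bullet> x0 \<noteq> 0"
    and "\<And>\<omega>. \<omega> \<in> space M \<Longrightarrow> x 0 \<omega> = x0"
    and "\<And>q \<omega>. q \<in> {1..k1} \<Longrightarrow> \<omega> \<in> space M \<Longrightarrow>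
           x q \<omega> = (real CARD('n) / mean_size \<gamma>1 \<gamma>2) *\<^sub>R
                     ((coord_proj (\<T> q \<omega>) ** A) *v x (q - 1) \<omega>)"
    and "\<And>q \<omega>. q \<in> {k1 + 1..k1 + k2} \<Longrightarrow> \<omega> \<in> space M \<Longrightarrow>
           x q \<omega> = (mat 1 + coord_proj (\<T> q \<omega>) ** (A - mat 1)) *v x (q - 1) \<omega>"
  shows "\<forall>j\<in>{1..CARD('n)}.
           integrable M (\<lambda>\<omega>. v j \<bullet> x k \<omega>) \<and>
           prob_space.expectation M (\<lambda>\<omega>. v j \<bullet> x k \<omega>) =
             lam j ^ k1 * (1 + mean_size \<gamma>1 \<gamma>2 / real CARD('n) * (lam j - 1)) ^ k2 * (v j \<bullet> x0)"
proof
  fix j assume j: "j \<in> {1..CARD('n)}"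
  interpret prob_space M by fact
  note gamma = assms(1-3) and indep = assms(5) and law = assms(6) and sym = assms(7)
    and eig = assms(8) and k = assms(15) and start = assms(17)
    and phase1 = assms(18) and phase2 = assms(19)
  define p where "p = mean_size \<gamma>1 \<gamma>2 / real CARD('n)"
  define R where "R = (\<lambda>q S. if q \<le> k1
      then (real CARD('n) / mean_size \<gamma>1 \<gamma>2) *\<^sub>R (coord_proj S ** A)
      else mat 1 + coord_proj S ** (A - mat 1))"
  have m: "mean_size \<gamma>1 \<gamma>2 > 0"
    using gamma by (intro mean_size_pos)
  have ind: "indep_vars (\<lambda>_. count_space UNIV) \<T> {1..}"
    using indep_vars_compose2[OF indep, of "\<lambda>_. snd" "\<lambda>_. count_space UNIV"] by simp
  have step: "x q \<omega> = R q (\<T> q \<omega>) *v x (q - 1) \<omega>" if "1 \<le> q" "q \<le> k" "\<omega> \<in> space M" for q \<omega>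
    using that phase1[of q \<omega>] phase2[of q \<omega>] k
    by (auto simp: R_def scaleR_matrix_vector_assoc)
  have int: "integrable M (\<lambda>\<omega>. indicator (\<T> q \<omega>) i :: real)" if "1 \<le> q" for q i
    using indep_vars_measurable[OF ind] that
    by (intro integrable_fun_of_finite[of "\<T> q" UNIV "\<lambda>S. indicator S i"]) auto
  have incl: "expectation (\<lambda>\<omega>. indicator (\<T> q \<omega>) i) = p" if "1 \<le> q" for q i
  proof -
    have "(\<lambda>\<omega>. (T q \<omega>, \<T> q \<omega>)) \<in> measurable M (count_space UNIV)"
      using indep_vars_measurable[OF indep] that by simp
    then have "expectation (\<lambda>\<omega>. indicator (snd (T q \<omega>, \<T> q \<omega>)) i :: real)
        = (\<integral>z. indicator (snd z) i \<partial>distr M (count_space UNIV) (\<lambda>\<omega>. (T q \<omega>, \<T> q \<omega>)))"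
      by (subst integral_distr) auto
    then show ?thesis
      using inclusion_prob_index_law[OF gamma(2,3), of i] law[OF that] by (simp add: p_def)
  qed
  note mean = mean_vector_coord_proj_matrix[OF int incl]
  have left: "v j v* A = lam j *\<^sub>R v j"
    using eig[OF j] sym by (metis vector_transpose_matrix)
  then have left': "v j v* (A - mat 1) = (lam j - 1) *\<^sub>R v j"
    by (simp add: algebra_simps)
  (* The factor N / E[T] in the first update is 1 / p, so it undoes the averaged projection. *)
  have first: "expectation (\<lambda>\<omega>. (v j v* R (Suc q) (\<T> (Suc q) \<omega>)) $ b) = lam j * v j $ b"
    if "q < k1" for q b
  proof -
    have "expectation (\<lambda>\<omega>. (v j v* R (Suc q) (\<T> (Suc q) \<omega>)) $ b)
        = (real CARD('n) / mean_size \<gamma>1 \<gamma>2) * (p * (v j v* A) $ b)"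
      using that mean(2)[of "Suc q" "v j" A b]
      by (simp add: R_def vector_scaleR_matrix_ac)
    then show ?thesis
      using m by (simp add: left p_def)
  qed
  have second: "expectation (\<lambda>\<omega>. (v j v* R (Suc q) (\<T> (Suc q) \<omega>)) $ b)
      = (1 + p * (lam j - 1)) * v j $ b" if "k1 \<le> q" for q b
    using that mean[of "Suc q" "v j" "A - mat 1" b]
    by (simp add: R_def vector_matrix_mult_add_rdistrib prob_space left left' algebra_simps)
  have advance: "expectation (\<lambda>\<omega>. v j \<bullet> x (Suc q) \<omega>) = \<mu> * expectation (\<lambda>\<omega>. v j \<bullet> x q \<omega>)"
    if "Suc q \<le> k" "\<And>b. expectation (\<lambda>\<omega>. (v j v* R (Suc q) (\<T> (Suc q) \<omega>)) $ b) = \<mu> * v j $ b"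
    for q \<mu>
    by (rule expectation_step_left_eigenvector[where Z = \<T> and y = x and R = R and n = k])
       (rule ind, erule start, erule (2) step, rule that, rule that)
  have powers1: "expectation (\<lambda>\<omega>. v j \<bullet> x q \<omega>) = lam j ^ q * (v j \<bullet> x0)" if "q \<le> k1" for q
    using that
  proof (induction q)
    case 0
    have "expectation (\<lambda>\<omega>. v j \<bullet> x 0 \<omega>) = expectation (\<lambda>\<omega>. v j \<bullet> x0)"
      using start by (intro Bochner_Integration.integral_cong) auto
    then show ?case by (simp add: prob_space)
  next
    case (Suc q)
    then show ?case
      using advance[of q, OF _ first] k by simp
  qed
  have powers2: "expectation (\<lambda>\<omega>. v j \<bullet> x (k1 + r) \<omega>)
      = lam j ^ k1 * (1 + p * (lam j - 1)) ^ r * (v j \<bullet> x0)" if "r \<le> k2" for r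
    using that
  proof (induction r)
    case 0
    then show ?case using powers1[of k1] by simp
  next
    case (Suc r)
    then show ?case
      using advance[of "k1 + r", OF _ second] k by simp
  qed
  have "integrable M (\<lambda>\<omega>. v j \<bullet> x k \<omega>)"
    by (rule state_integrable[of \<T> x x0 k "\<lambda>q S. (*v) (R q S)" k "\<lambda>u. v j \<bullet> u",
          OF ind start step order_refl])
  then show "integrable M (\<lambda>\<omega>. v j \<bullet> x k \<omega>) \<and>
      expectation (\<lambda>\<omega>. v j \<bullet> x k \<omega>) =
        lam j ^ k1 * (1 + mean_size \<gamma>1 \<gamma>2 / real CARD('n) * (lam j - 1)) ^ k2 * (v j \<bullet> x0)"
    using powers2[of k2] k by (simp add: p_def)
qed

end
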